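(* Let $d\le n$ and let $\mathbf X\in\mathbb R^{n\times d}$ be any matrix of rank $d$ all of whose $n$ rows are standard basis vectors of $\mathbb R^d$. Then for any randomized learning algorithm which selects a random multiset $S$ of elements of $\{1,\dots,n\}$ of size $|S|\le(d-1)\ln(d)$ via i.i.d. sampling from any distribution over $\{1,\dots,n\}$ and uses any weight function $\mathbf w(S)$, there is a response vector $\mathbf y\in\mathbb R^n$ satisfying $$L(\mathbf w^* )=0\quad\text{and}\quad L(\mathbf w(S))>0\ \text{ with probability at least }1/2.$$
   Context: $L(\mathbf w)=\|\mathbf X\mathbf w-\mathbf y\|^2$ is the square loss on all $n$ rows and $\mathbf w^*$ is a minimizer of $L$. The sampling distribution may depend on $\mathbf X$ but not on $\mathbf y$. A weight function assigns to the sampled $S$ and the responses $\mathbf y_S$ (the entries of $\mathbf y$ indexed by $S$) a vector $\mathbf w(S)=\mathbf w(\mathbf X,S,\mathbf y_S)\in\mathbb R^d$; it depends on $\mathbf y$ only through $\mathbf y_S$. *)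

theory Defs
  imports "HOL-Probability.Probability" "HOL-Library.Multiset"
begin

definition square_loss :: "real^'d^'n \<Rightarrow> real^'n \<Rightarrow> real^'d \<Rightarrow> real" where
  "square_loss X y w = (norm (X *v w - y))\<^sup>2"

text \<open>The size-\<open>s\<close> multiset obtained from \<open>s\<close> i.i.d. draws from \<open>p\<close>, forgetting the order.\<close>

definition iid_sample :: "nat \<Rightarrow> 'n pmf \<Rightarrow> 'n multiset pmf" where
  "iid_sample s p = map_pmf mset (replicate_pmf s p)"

text \<open>The vector \<open>y\<^sub>S\<close>, as a function on the row indices occurring in \<open>S\<close> (\<open>undefined\<close> elsewhere).
  The entry of a row sampled repeatedly is the same for each occurrence, so it is recorded once.\<close>

definition responses :: "real^'n \<Rightarrow> 'n multiset \<Rightarrow> 'n \<Rightarrow> real" where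
  "responses y S = restrict (\<lambda>i. y $ i) (set_mset S)"

end

theory Submission
  imports Defs
begin

text \<open>Write \<open>c i\<close> for the position of the \<open>1\<close> in row \<open>i\<close>, so that \<open>y = X w\<^sup>*\<close> means
  \<open>y i = w\<^sup>* (c i)\<close>. Sampling rows is then collecting \<open>d\<close> coupons, coupon \<open>j\<close> having some
  probability \<open>q j\<close>. All coupons are collected in \<open>s\<close> draws with probability at most
  \<open>\<Prod>j. 1 - (1 - q j)^s \<le> exp (- (\<Sum>j. (1 - q j)^s)) \<le> exp (-1)\<close>: by convexity the sum
  is at least \<open>d (1 - 1/d)^s\<close>, which is at least \<open>1\<close> for \<open>s \<le> (d - 1) ln d\<close>. A sample missing
  coupon \<open>j\<close> carries no information on \<open>w\<^sup>* j\<close>; as there are finitely many samples, counting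
  vectors with entries in a large finite set yields one \<open>w\<^sup>*\<close> on which every incomplete
  sample errs. Full rank turns such an error into positive loss.\<close>

text \<open>Multiplied out, the right-hand product has only nonnegative terms; the left-hand side
  keeps those with at most one factor \<open>b j\<close>.\<close>

lemma prod_add_ge_first_order:
  fixes a b :: "'a \<Rightarrow> real"
  assumes "finite A" "\<And>j. j \<in> A \<Longrightarrow> 0 \<le> a j" "\<And>j. j \<in> A \<Longrightarrow> 0 \<le> b j"
  shows "(\<Prod>j\<in>A. a j) + (\<Sum>j\<in>A. b j * (\<Prod>i\<in>A - {j}. a i)) \<le> (\<Prod>j\<in>A. a j + b j)"
  using assms
proof (induction A rule: finite_induct)
  case empty
  then show ?case by simp
next
  case (insert k A)
  have "(\<Prod>i\<in>insert k A - {j}. a i) = a k * (\<Prod>i\<in>A - {j}. a i)" if "j \<in> A" for j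
  proof -
    have "insert k A - {j} = insert k (A - {j})"
      using that insert.hyps by auto
    then show ?thesis using insert.hyps by simp
  qed
  then have "(\<Sum>j\<in>A. b j * (\<Prod>i\<in>insert k A - {j}. a i))
      = a k * (\<Sum>j\<in>A. b j * (\<Prod>i\<in>A - {j}. a i))"
    by (simp add: sum_distrib_left mult_ac)
  moreover have "insert k A - {k} = A"
    using insert.hyps by auto
  ultimately have "(\<Prod>j\<in>insert k A. a j) + (\<Sum>j\<in>insert k A. b j * (\<Prod>i\<in>insert k A - {j}. a i))
      = a k * ((\<Prod>j\<in>A. a j) + (\<Sum>j\<in>A. b j * (\<Prod>i\<in>A - {j}. a i))) + b k * (\<Prod>j\<in>A. a j)"
    using insert.hyps by (simp add: algebra_simps)
  also have "\<dots> \<le> a k * (\<Prod>j\<in>A. a j + b j) + b k * (\<Prod>j\<in>A. a j + b j)"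
    using insert.IH insert.prems by (intro add_mono mult_left_mono prod_mono) auto
  also have "\<dots> = (\<Prod>j\<in>insert k A. a j + b j)"
    using insert.hyps by (simp add: algebra_simps)
  finally show ?case .
qed

text \<open>Induction on the number of draws, conditioning on the first one, avoids any appeal to the theory
  of negatively associated random variables.\<close>

lemma prob_collect_le_prod:
  fixes p :: "'a pmf" and c :: "'a \<Rightarrow> 'b"
  defines "q \<equiv> \<lambda>j. measure_pmf.prob p (c -` {j})"
  assumes "finite A"
  shows "measure_pmf.prob (replicate_pmf s p) {xs. A \<subseteq> c ` set xs}
         \<le> (\<Prod>j\<in>A. 1 - (1 - q j) ^ s)"
  using \<open>finite A\<close>
proof (induction s arbitrary: A)
  case 0
  then show ?case
    by (cases "A = {}") auto
next
  case (Suc s)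
  define a where "a j = 1 - (1 - q j) ^ s" for j
  have q: "0 \<le> q j" "q j \<le> 1" for j
    by (auto simp: q_def)
  have a: "0 \<le> a j" "a j \<le> 1" for j
    using q[of j] by (auto simp: a_def power_le_one)
  have int: "integrable (measure_pmf p) f" if "\<And>x. \<bar>f x\<bar> \<le> 1" for f :: "'a \<Rightarrow> real"
    using that by (intro measure_pmf.integrable_const_bound[where B = 1]) auto
  have int_ind: "integrable (measure_pmf p) (\<lambda>x. indicator (c -` {j}) x * k)" for j and k :: real
    by (intro Bochner_Integration.integrable_mult_left int) (auto simp: indicator_le_1)
  \<comment> \<open>At most one factor is removed. A form affine in the indicators lets integration
    turn each indicator into \<open>q j\<close>, and it avoids dividing by \<open>a j\<close>, which
    may be 0.\<close>
  have step: "(\<Prod>j\<in>A - {i}. a j)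
      = (\<Prod>j\<in>A. a j) + (\<Sum>j\<in>A. indicator {j} i * ((1 - a j) * (\<Prod>k\<in>A - {j}. a k)))" for i
  proof (cases "i \<in> A")
    case True
    have "(\<Sum>j\<in>A. indicator {j} i * ((1 - a j) * (\<Prod>k\<in>A - {j}. a k)))
        = (\<Sum>j\<in>A. if i = j then (1 - a j) * (\<Prod>k\<in>A - {j}. a k) else 0)"
      by (intro sum.cong) (auto simp: indicator_def)
    then show ?thesis
      using True Suc.prems by (simp add: prod.remove[of A i a] algebra_simps)
  next
    case False
    then have "(\<Sum>j\<in>A. indicator {j} i * ((1 - a j) * (\<Prod>k\<in>A - {j}. a k))) = 0"
      by (intro sum.neutral) (auto simp: indicator_def)
    then show ?thesis using False by simp
  qed
  have rep: "replicate_pmf (Suc s) p = bind_pmf p (\<lambda>x. map_pmf ((#) x) (replicate_pmf s p))"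
    by (simp add: map_pmf_def)
  \<comment> \<open>After a first draw \<open>x\<close>, the other \<open>s\<close> draws must
    supply \<open>A - {c x}\<close>; this is why the induction keeps \<open>A\<close>
    arbitrary.\<close>
  have "measure_pmf.prob (replicate_pmf (Suc s) p) {xs. A \<subseteq> c ` set xs}
      = (\<integral>x. measure_pmf.prob (replicate_pmf s p) {xs. A - {c x} \<subseteq> c ` set xs} \<partial>measure_pmf p)"
    unfolding rep measure_pmf_bind
    by (subst measure_pmf.measure_bind[where N = "count_space UNIV"])
       (auto simp: measure_pmf_in_subprob_space vimage_def Diff_subset_conv
             intro!: Bochner_Integration.integral_cong)
  also have "\<dots> \<le> (\<integral>x. (\<Prod>j\<in>A - {c x}. a j) \<partial>measure_pmf p)"
    using Suc.IH Suc.prems a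
    by (intro integral_mono int) (auto simp: a_def abs_prod intro!: prod_le_1)
  also have "\<dots> = (\<integral>x. (\<Prod>j\<in>A. a j)
      + (\<Sum>j\<in>A. indicator (c -` {j}) x * ((1 - a j) * (\<Prod>k\<in>A - {j}. a k))) \<partial>measure_pmf p)"
    by (subst step) (simp add: indicator_def)
  also have "\<dots> = (\<Prod>j\<in>A. a j) + (\<Sum>j\<in>A. q j * ((1 - a j) * (\<Prod>k\<in>A - {j}. a k)))"
    using int_ind
    by (simp add: Bochner_Integration.integral_add Bochner_Integration.integral_sum q_def)
  also have "\<dots> = (\<Prod>j\<in>A. a j) + (\<Sum>j\<in>A. (q j * (1 - a j)) * (\<Prod>k\<in>A - {j}. a k))"
    by (simp add: mult_ac)
  \<comment> \<open>Here \<open>a j\<close> is the chance of coupon \<open>j\<close> among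
    \<open>s\<close> later draws, and \<open>q j * (1 - a j)\<close> that of seeing it in the first
    draw only.\<close>
  also have "\<dots> \<le> (\<Prod>j\<in>A. a j + q j * (1 - a j))"
    using Suc.prems a q by (intro prod_add_ge_first_order) auto
  also have "\<dots> = (\<Prod>j\<in>A. 1 - (1 - q j) ^ Suc s)"
    by (simp add: a_def algebra_simps)
  finally show ?case .
qed

lemma convex_on_power_nonneg: "convex_on {0::real..} (\<lambda>x. x ^ n)"
proof (cases "even n")
  case True
  then show ?thesis
    using convex_power_even convex_on_subset by blast
qed (rule convex_power_odd)

text \<open>This is where the threshold comes from: 1 + x \<le> exp x at x = 1/(d - 1), inverted,
  gives 1 - 1/d \<ge> exp (-1/(d - 1)), and (d - 1) ln d such factors multiply to 1/d.\<close>

lemma one_minus_inverse_power_ge: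
  fixes d :: real
  assumes "d \<ge> 1" "real s \<le> (d - 1) * ln d"
  shows "1 / d \<le> (1 - 1 / d) ^ s"
\<comment> \<open>At \<open>d = 1\<close> the exponent 1/(d - 1) is meaningless, but then
  \<open>s = 0\<close> and the claim holds because \<open>0 ^ 0 = 1\<close>.\<close>
proof (cases "d = 1")
  case True
  then show ?thesis using assms by simp
next
  case False
  then have d: "d > 1" using assms by simp
  have "1 / (1 - 1 / d) = 1 + 1 / (d - 1)"
    using d by (simp add: field_simps)
  also have "\<dots> \<le> exp (1 / (d - 1))"
    by simp
  finally have "exp (- (1 / (d - 1))) \<le> 1 - 1 / d"
    using d by (simp add: exp_minus field_simps)
  then have "exp (- (1 / (d - 1))) ^ s \<le> (1 - 1 / d) ^ s"
    by (intro power_mono) auto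
  moreover have "exp (- (1 / (d - 1))) ^ s = exp (- (real s / (d - 1)))"
    by (simp flip: exp_of_nat_mult)
  moreover have "exp (- ln d) \<le> exp (- (real s / (d - 1)))"
    using d assms by (simp add: field_simps)
  moreover have "exp (- ln d) = 1 / d"
    using d by (simp add: exp_minus field_simps)
  ultimately show ?thesis by linarith
qed

lemma prob_collect_all_le_half:
  fixes p :: "'a pmf" and c :: "'a \<Rightarrow> 'b::finite"
  assumes "real s \<le> (real CARD('b) - 1) * ln (real CARD('b))"
  shows "measure_pmf.prob (replicate_pmf s p) {xs. c ` set xs = UNIV} \<le> 1 / 2"
proof -
  define q where "q j = measure_pmf.prob p (c -` {j})" for j
  define d where "d = real CARD('b)"
  have d: "d \<ge> 1" unfolding d_def by (simp add: Suc_leI)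
  have q: "0 \<le> q j" "q j \<le> 1" for j by (auto simp: q_def)
  have "(\<Sum>j\<in>UNIV. q j) = measure_pmf.prob p (\<Union>j\<in>UNIV. c -` {j})"
    unfolding q_def
    by (subst measure_pmf.finite_measure_finite_Union) (auto simp: disjoint_family_on_def)
  also have "(\<Union>j\<in>UNIV. c -` {j}) = UNIV" by auto
  finally have q_sum: "(\<Sum>j\<in>UNIV. q j) = 1" by simp
  \<comment> \<open>Jensen with equal weights 1/d: since the \<open>q j\<close> sum to 1, the mean
    of \<open>1 - q j\<close> is 1 - 1/d whatever \<open>p\<close> is.\<close>
  have "(1 - 1 / d) ^ s = (\<Sum>j\<in>UNIV. (1 / d) *\<^sub>R (1 - q j)) ^ s"
    using d by (simp add: q_sum sum_subtractf flip: sum_divide_distrib d_def) (simp add: field_simps)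
  also have "\<dots> \<le> (\<Sum>j\<in>UNIV. (1 / d) * (1 - q j) ^ s)"
    using d q by (intro convex_on_sum[OF _ _ convex_on_power_nonneg]) (auto simp: d_def)
  also have "\<dots> = (\<Sum>j\<in>UNIV. (1 - q j) ^ s) / d"
    by (simp add: sum_divide_distrib)
  finally have "1 / d \<le> (\<Sum>j\<in>UNIV. (1 - q j) ^ s) / d"
    using one_minus_inverse_power_ge[OF d, of s] assms by (simp add: d_def)
  then have missed: "1 \<le> (\<Sum>j\<in>UNIV. (1 - q j) ^ s)"
    using d by (simp add: divide_le_cancel)
  have "measure_pmf.prob (replicate_pmf s p) {xs. c ` set xs = UNIV}
      \<le> (\<Prod>j\<in>UNIV. 1 - (1 - q j) ^ s)"
    using prob_collect_le_prod[of UNIV s p c] by (simp add: q_def top.extremum_unique)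
  also have "\<dots> \<le> (\<Prod>j\<in>UNIV. exp (- ((1 - q j) ^ s)))"
  proof (intro prod_mono conjI)
    fix j
    show "0 \<le> 1 - (1 - q j) ^ s" using q[of j] by (simp add: power_le_one)
    show "1 - (1 - q j) ^ s \<le> exp (- ((1 - q j) ^ s))"
      using exp_ge_add_one_self[of "- ((1 - q j) ^ s)"] by simp
  qed
  also have "\<dots> = exp (- (\<Sum>j\<in>UNIV. (1 - q j) ^ s))"
    by (simp add: exp_sum sum_negf flip: sum_negf)
  also have "\<dots> \<le> exp (- 1)"
    using missed by simp
  also have "\<dots> \<le> 1 / 2"
    using exp_ge_add_one_self[of 1] by (simp add: exp_minus field_simps)
  finally show ?thesis .
qed

text \<open>Here \<open>g t\<close> guesses the coordinate \<open>m t\<close> of \<open>u\<close>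
  from the other coordinates. If each coordinate ranges over |F| + 1 values, a guess is right for at
  most a fraction 1/(|F| + 1) of the vectors, so the |F| guesses together leave some vector
  uncovered.\<close>

lemma exists_avoiding_predictions:
  fixes g :: "'t \<Rightarrow> ('d::finite \<Rightarrow> real) \<Rightarrow> real" and m :: "'t \<Rightarrow> 'd"
  assumes "finite F"
    and g: "\<And>t u v. t \<in> F \<Longrightarrow> (\<And>j. j \<noteq> m t \<Longrightarrow> u j = v j) \<Longrightarrow> g t u = g t v"
  shows "\<exists>u. \<forall>t\<in>F. g t u \<noteq> u (m t)"
proof (rule ccontr)
  assume contra: "\<not> ?thesis"
  define B where "B = real ` {..<Suc (card F)}"
  define V where "V = (UNIV :: 'd set) \<rightarrow>\<^sub>E B"
  define bad where "bad t = {u \<in> V. g t u = u (m t)}" for t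
  have B: "finite B" "card B = Suc (card F)"
    by (simp_all add: B_def card_image)
  have V: "finite V" "card V = Suc (card F) ^ CARD('d)"
    using B by (simp_all add: V_def card_funcsetE finite_PiE)
  have card_bad: "card (bad t) \<le> Suc (card F) ^ (CARD('d) - 1)" if t: "t \<in> F" for t
  proof -
    \<comment> \<open>The coordinates off \<open>m t\<close> fix the guess, and on
      \<open>bad t\<close> the guess is the missing coordinate.\<close>
    have "inj_on (\<lambda>u. restrict u (- {m t})) (bad t)"
    proof (rule inj_onI)
      fix u v
      assume u: "u \<in> bad t" and v: "v \<in> bad t"
        and eq: "restrict u (- {m t}) = restrict v (- {m t})"
      have off: "u j = v j" if "j \<noteq> m t" for j
        using fun_cong[OF eq, of j] that by simp
      have "u (m t) = g t u" using u by (simp add: bad_def)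
      also have "\<dots> = g t v" using g[OF t off] .
      also have "\<dots> = v (m t)" using v by (simp add: bad_def)
      finally show "u = v" using off by (metis ext)
    qed
    moreover have "(\<lambda>u. restrict u (- {m t})) ` bad t \<subseteq> (- {m t}) \<rightarrow>\<^sub>E B"
      by (auto simp: bad_def V_def PiE_iff split: if_splits)
    ultimately have "card (bad t) \<le> card ((- {m t}) \<rightarrow>\<^sub>E B)"
      using B by (intro card_inj_on_le) (auto intro: finite_PiE)
    also have "\<dots> = Suc (card F) ^ (CARD('d) - 1)"
      using B unfolding Compl_eq_Diff_UNIV by (simp add: card_funcsetE card_Diff_singleton)
    finally show ?thesis .
  qed
  have "V \<subseteq> (\<Union>t\<in>F. bad t)"
    using contra by (auto simp: bad_def)
  moreover have "finite (\<Union>t\<in>F. bad t)"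
    using \<open>finite F\<close> V by (auto simp: bad_def)
  ultimately have "card V \<le> card (\<Union>t\<in>F. bad t)"
    by (rule card_mono[rotated])
  also have "\<dots> \<le> (\<Sum>t\<in>F. card (bad t))"
    using \<open>finite F\<close> by (rule card_UN_le)
  also have "\<dots> \<le> card F * Suc (card F) ^ (CARD('d) - 1)"
    using sum_bounded_above[of F "\<lambda>t. card (bad t)"] card_bad by simp
  also have "\<dots> < Suc (card F) * Suc (card F) ^ (CARD('d) - 1)"
    by simp
  also have "\<dots> = card V"
    by (simp add: V power_eq_if)
  finally show False by simp
qed

theorem corollary3p6:
  fixes X :: "real^'d^'n"
    and p :: "'n pmf"
    and s :: nat
    and w :: "real^'d^'n \<Rightarrow> 'n multiset \<Rightarrow> ('n \<Rightarrow> real) \<Rightarrow> real^'d"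
  assumes "CARD('d) \<le> CARD('n)"
    and "rank X = CARD('d)"
    and "\<And>i. \<exists>j. row i X = axis j 1"
    and "real s \<le> (real CARD('d) - 1) * ln (real CARD('d))"
  shows "\<exists>y wstar. is_arg_min (square_loss X y) (\<lambda>_. True) wstar
           \<and> square_loss X y wstar = 0
           \<and> measure_pmf.prob (iid_sample s p)
                {S. square_loss X y (w X S (responses y S)) > 0} \<ge> 1/2"
proof -
  from assms(3) obtain c where c: "\<And>i. row i X = axis (c i) 1" by metis
  have Xv: "(X *v v) $ i = v $ c i" for v i
    using c[of i] by (simp add: matrix_vector_mul_component row_def vec_nth_inverse inner_axis')
  have inj: "inj ((*v) X)"
    using assms(2) by (simp add: full_rank_injective)
  \<comment> \<open>Restricting to the support makes \<open>F\<close> finite, as the counting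
    argument requires.\<close>
  define F where "F = {S \<in> set_pmf (iid_sample s p). c ` set_mset S \<noteq> UNIV}"
  define m where "m S = (SOME j. j \<notin> c ` set_mset S)" for S
  have m: "m S \<notin> c ` set_mset S" if "S \<in> F" for S
    using that unfolding F_def m_def by (metis (mono_tags, lifting) UNIV_eq_I mem_Collect_eq someI_ex)
  define y where "y u = X *v (\<chi> j. u j)" for u
  have "finite {xs :: 'n list. set xs \<subseteq> UNIV \<and> length xs = s}"
    by (rule finite_lists_length_eq) simp
  then have "finite F"
    unfolding F_def iid_sample_def by (auto simp: set_replicate_pmf)
  \<comment> \<open>The guess for \<open>u (m S)\<close> is the entry \<open>m S\<close> of the
    learned weights: no sampled row has its 1 in column \<open>m S\<close>, so
    \<open>u (m S)\<close> leaves the responses unchanged.\<close>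
  moreover have "w X S (responses (y u) S) $ m S = w X S (responses (y v) S) $ m S"
    if "S \<in> F" and eq: "\<And>j. j \<noteq> m S \<Longrightarrow> u j = v j" for S u v
  proof -
    have "responses (y u) S = responses (y v) S"
      unfolding responses_def
    proof (rule restrict_ext)
      fix i assume "i \<in> set_mset S"
      then have "c i \<noteq> m S" using m[OF \<open>S \<in> F\<close>] by (metis imageI)
      then show "y u $ i = y v $ i" by (simp add: y_def Xv eq)
    qed
    then show ?thesis by simp
  qed
  ultimately obtain u where u: "\<And>S. S \<in> F \<Longrightarrow> w X S (responses (y u) S) $ m S \<noteq> u (m S)"
    using exists_avoiding_predictions[of F m "\<lambda>S u. w X S (responses (y u) S) $ m S"] by blast
  define wstar where "wstar = (\<chi> j. u j)"
  have zero: "square_loss X (y u) wstar = 0"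
    by (simp add: square_loss_def y_def wstar_def)
  have "is_arg_min (square_loss X (y u)) (\<lambda>_. True) wstar"
    using zero by (auto simp: is_arg_min_def square_loss_def not_less)
  moreover have "1 / 2 \<le> measure_pmf.prob (iid_sample s p)
      {S. square_loss X (y u) (w X S (responses (y u) S)) > 0}"
  proof -
    have "square_loss X (y u) (w X S (responses (y u) S)) > 0" if "S \<in> F" for S
    proof -
      have "w X S (responses (y u) S) \<noteq> wstar"
        using u[OF that] by (auto simp: wstar_def)
      then have "X *v w X S (responses (y u) S) \<noteq> y u"
        using inj by (auto simp: y_def wstar_def dest: injD)
      then show ?thesis by (simp add: square_loss_def)
    qed
    then have le: "measure_pmf.prob (iid_sample s p) F
        \<le> measure_pmf.prob (iid_sample s p) {S. square_loss X (y u) (w X S (responses (y u) S)) > 0}"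
      by (intro measure_pmf.finite_measure_mono) auto
    \<comment> \<open>Dropping the support condition changes the event by a null set only.\<close>
    have "measure_pmf.prob (iid_sample s p) F
        = measure_pmf.prob (iid_sample s p) {S. c ` set_mset S \<noteq> UNIV}"
      by (intro measure_eq_AE) (auto simp: F_def AE_measure_pmf_iff)
    also have "\<dots> = measure_pmf.prob (replicate_pmf s p) (- {xs. c ` set xs = UNIV})"
      unfolding iid_sample_def by (simp add: vimage_def Compl_eq)
    also have "\<dots> = 1 - measure_pmf.prob (replicate_pmf s p) {xs. c ` set xs = UNIV}"
      by (subst measure_pmf.prob_compl[symmetric]) (auto simp: Compl_eq_Diff_UNIV)
    also have "\<dots> \<ge> 1 / 2"
      using prob_collect_all_le_half[OF assms(4), of p c] by simp
    finally show ?thesis using le by simp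
  qed
  ultimately show ?thesis using zero by blast
qed

end
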